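(* Let $(\mathcal{M},[\cdot,\cdot])$ be a Banach--Malcev algebra and let $\alpha$ be an almost periodic automorphism of $\mathcal{M}$, i.e. an automorphism such that the orbit $\{\alpha^n(x):n\in\mathbb{Z}\}$ is relatively compact in $\mathcal{M}$ for every $x\in\mathcal{M}$. Let $\mathcal{M}_{\mathrm{ap}}\subset\mathcal{M}$ denote the closed subspace of almost periodic elements. Then $\mathcal{M}_{\mathrm{ap}}$ is invariant under the original bracket $[\cdot,\cdot]$ (that is, $[x,y]\in\mathcal{M}_{\mathrm{ap}}$ for all $x,y\in\mathcal{M}_{\mathrm{ap}}$), and $(\mathcal{M}_{\mathrm{ap}},[\cdot,\cdot]_\alpha,\alpha)$, with $[x,y]_\alpha:=\alpha([x,y])$, is a Hom--Banach--Malcev algebra.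
   Context: A Malcev bracket on a complex vector space is a bilinear skew-symmetric bracket satisfying the Malcev identity $J(x,y,[x,z])=[J(x,y,z),x]$, where $J(x,y,z)=[x,[y,z]]+[y,[z,x]]+[z,[x,y]]$. A Banach--Malcev algebra is a complex Banach space with a continuous Malcev bracket. An automorphism of a Banach--Malcev algebra is a bounded linear bijection $\alpha$ with $\alpha([x,y])=[\alpha(x),\alpha(y)]$ for all $x,y$. An element $x\in\mathcal{M}$ is almost periodic (for $\alpha$) if $\{\alpha^n(x):n\in\mathbb{Z}\}$ is relatively compact in norm. A Hom--Banach--Malcev algebra $(\mathcal{M},[\cdot,\cdot]_\alpha,\alpha)$ is a complex Banach space $\mathcal{M}$ with a bounded linear map $\alpha$ and a continuous bilinear bracket $[\cdot,\cdot]_\alpha$ such that $[x,y]_\alpha=\alpha([x,y])$ for a continuous Malcev bracket $[\cdot,\cdot]$ on $\mathcal{M}$, and such that the Hom--Malcev identity \[ J_\alpha(\alpha(x),\alpha(y),[x,z]_\alpha)=[J_\alpha(x,y,z),\alpha^2(x)]_\alpha \] holds for all $x,y,z$, where $J_\alpha(x,y,z):=[\alpha(x),[y,z]_\alpha]_\alpha+[\alpha(y),[z,x]_\alpha]_\alpha+[\alpha(z),[x,y]_\alpha]_\alpha$. *)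

theory Defs
  imports "HOL-Analysis.Analysis"
begin

section \<open>Complex Banach spaces\<close>

text \<open>
  The distribution only has real normed spaces.  As there, scalar multiplication is a class
  parameter; the complex one is required to extend the real one.
\<close>

class scaleC = scaleR +
  fixes scaleC :: "complex \<Rightarrow> 'a \<Rightarrow> 'a" (infixr "*\<^sub>C" 75)
  assumes scaleR_scaleC: "scaleR r = scaleC (complex_of_real r)"

class complex_vector = scaleC + ab_group_add +
  assumes scaleC_add_right: "a *\<^sub>C (x + y) = a *\<^sub>C x + a *\<^sub>C y"
    and scaleC_add_left: "(a + b) *\<^sub>C x = a *\<^sub>C x + b *\<^sub>C x"
    and scaleC_scaleC: "a *\<^sub>C b *\<^sub>C x = (a * b) *\<^sub>C x"
    and scaleC_one: "1 *\<^sub>C x = x"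

class complex_normed_vector = complex_vector + real_normed_vector +
  assumes norm_scaleC: "norm (a *\<^sub>C x) = cmod a * norm x"

class cbanach = complex_normed_vector + banach

instantiation complex :: cbanach
begin

definition scaleC_complex :: "complex \<Rightarrow> complex \<Rightarrow> complex"
  where "scaleC_complex a x = a * x"

instance
  by standard
    (auto simp: scaleC_complex_def scaleR_conv_of_real algebra_simps norm_mult)

end

global_interpretation complex_vector: vector_space "scaleC :: complex \<Rightarrow> 'a \<Rightarrow> 'a::complex_vector"
  by standard (simp_all add: scaleC_add_right scaleC_add_left scaleC_scaleC scaleC_one)


section \<open>Linear maps and brackets on a subspace\<close>

text \<open>
  A Banach space is represented by a carrier set: a complete complex linear subspace of a type of
  class \<open>cbanach\<close>.  Maps and brackets are functions on the whole type that are
  only constrained on the carrier, which they have to preserve.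
\<close>

definition banach_carrier :: "'a::cbanach set \<Rightarrow> bool"
  where "banach_carrier S \<longleftrightarrow> complex_vector.subspace S \<and> complete S"

definition clinear_on :: "'a::cbanach set \<Rightarrow> ('a \<Rightarrow> 'a) \<Rightarrow> bool"
  where "clinear_on S f \<longleftrightarrow>
    (\<forall>x\<in>S. f x \<in> S) \<and>
    (\<forall>x\<in>S. \<forall>y\<in>S. f (x + y) = f x + f y) \<and>
    (\<forall>c. \<forall>x\<in>S. f (c *\<^sub>C x) = c *\<^sub>C f x)"

definition bounded_clinear_on :: "'a::cbanach set \<Rightarrow> ('a \<Rightarrow> 'a) \<Rightarrow> bool"
  where "bounded_clinear_on S f \<longleftrightarrow>
    clinear_on S f \<and> (\<exists>K. \<forall>x\<in>S. norm (f x) \<le> K * norm x)"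

definition continuous_bilinear_on :: "'a::cbanach set \<Rightarrow> ('a \<Rightarrow> 'a \<Rightarrow> 'a) \<Rightarrow> bool"
  where "continuous_bilinear_on S br \<longleftrightarrow>
    (\<forall>x\<in>S. clinear_on S (\<lambda>y. br x y)) \<and>
    (\<forall>y\<in>S. clinear_on S (\<lambda>x. br x y)) \<and>
    continuous_on (S \<times> S) (\<lambda>(x, y). br x y)"


section \<open>Banach--Malcev algebras\<close>

definition malcev_jacobian :: "('a::cbanach \<Rightarrow> 'a \<Rightarrow> 'a) \<Rightarrow> 'a \<Rightarrow> 'a \<Rightarrow> 'a \<Rightarrow> 'a"
  where "malcev_jacobian br x y z = br x (br y z) + br y (br z x) + br z (br x y)"

definition continuous_malcev_bracket_on :: "'a::cbanach set \<Rightarrow> ('a \<Rightarrow> 'a \<Rightarrow> 'a) \<Rightarrow> bool"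
  where "continuous_malcev_bracket_on S br \<longleftrightarrow>
    continuous_bilinear_on S br \<and>
    (\<forall>x\<in>S. \<forall>y\<in>S. br x y = - br y x) \<and>
    (\<forall>x\<in>S. \<forall>y\<in>S. \<forall>z\<in>S. malcev_jacobian br x y (br x z) = br (malcev_jacobian br x y z) x)"

definition banach_malcev_algebra :: "'a::cbanach set \<Rightarrow> ('a \<Rightarrow> 'a \<Rightarrow> 'a) \<Rightarrow> bool"
  where "banach_malcev_algebra S br \<longleftrightarrow>
    banach_carrier S \<and> continuous_malcev_bracket_on S br"

definition banach_malcev_automorphism ::
    "'a::cbanach set \<Rightarrow> ('a \<Rightarrow> 'a \<Rightarrow> 'a) \<Rightarrow> ('a \<Rightarrow> 'a) \<Rightarrow> bool"
  where "banach_malcev_automorphism S br \<alpha> \<longleftrightarrow>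
    bounded_clinear_on S \<alpha> \<and> bij_betw \<alpha> S S \<and>
    (\<forall>x\<in>S. \<forall>y\<in>S. \<alpha> (br x y) = br (\<alpha> x) (\<alpha> y))"


section \<open>Almost periodic elements\<close>

text \<open>Only meaningful for bijective \<open>\<alpha>\<close>, because of \<open>inv\<close>.\<close>

definition int_iterate :: "('a \<Rightarrow> 'a) \<Rightarrow> int \<Rightarrow> 'a \<Rightarrow> 'a"
  where "int_iterate \<alpha> n = (if n \<ge> 0 then \<alpha> ^^ nat n else inv \<alpha> ^^ nat (- n))"

definition almost_periodic :: "('a::cbanach \<Rightarrow> 'a) \<Rightarrow> 'a \<Rightarrow> bool"
  where "almost_periodic \<alpha> x \<longleftrightarrow> compact (closure {int_iterate \<alpha> n x | n. True})"

definition ap_elements :: "('a::cbanach \<Rightarrow> 'a) \<Rightarrow> 'a set"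
  where "ap_elements \<alpha> = {x. almost_periodic \<alpha> x}"


section \<open>Hom--Banach--Malcev algebras\<close>

definition hom_jacobian ::
    "('a::cbanach \<Rightarrow> 'a) \<Rightarrow> ('a \<Rightarrow> 'a \<Rightarrow> 'a) \<Rightarrow> 'a \<Rightarrow> 'a \<Rightarrow> 'a \<Rightarrow> 'a"
  where "hom_jacobian \<alpha> hbr x y z =
    hbr (\<alpha> x) (hbr y z) + hbr (\<alpha> y) (hbr z x) + hbr (\<alpha> z) (hbr x y)"

definition hom_banach_malcev_algebra ::
    "'a::cbanach set \<Rightarrow> ('a \<Rightarrow> 'a \<Rightarrow> 'a) \<Rightarrow> ('a \<Rightarrow> 'a) \<Rightarrow> bool"
  where "hom_banach_malcev_algebra S hbr \<alpha> \<longleftrightarrow>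
    banach_carrier S \<and>
    bounded_clinear_on S \<alpha> \<and>
    continuous_bilinear_on S hbr \<and>
    (\<exists>br. continuous_malcev_bracket_on S br \<and> (\<forall>x\<in>S. \<forall>y\<in>S. hbr x y = \<alpha> (br x y))) \<and>
    (\<forall>x\<in>S. \<forall>y\<in>S. \<forall>z\<in>S.
      hom_jacobian \<alpha> hbr (\<alpha> x) (\<alpha> y) (hbr x z) = hbr (hom_jacobian \<alpha> hbr x y z) (\<alpha> (\<alpha> x)))"

end

theory Submission
  imports Defs
begin

(* Twisting a bracket by a morphism \<alpha> multiplies the Jacobian by \<alpha>^2, so the Hom-Malcev identity is
   \<alpha>^3 applied to the Malcev identity. Since every orbit is assumed relatively compact, the almost
   periodic elements form the whole space. *)

text \<open>Linearity is known only on \<open>S\<close>, so the bound is applied to differences of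
  points of \<open>S\<close>, which stay in the subspace; this is a Lipschitz estimate.\<close>

lemma bounded_clinear_on_imp_continuous_on:
  assumes f: "bounded_clinear_on S f" and S: "complex_vector.subspace S"
  shows "continuous_on S f"
proof -
  obtain K where K: "\<forall>x\<in>S. norm (f x) \<le> K * norm x"
    using f by (auto simp: bounded_clinear_on_def)
  have minus: "f (x - y) = f x - f y" if "x \<in> S" "y \<in> S" for x y
  proof -
    have "x - y \<in> S"
      using that S complex_vector.subspace_diff by blast
    then have "f (x - y + y) = f (x - y) + f y"
      using that f by (simp only: bounded_clinear_on_def clinear_on_def)
    then show ?thesis by simp
  qed
  \<comment> \<open>A Lipschitz constant must be nonnegative, whereas \<open>K\<close> may be
    negative when \<open>S\<close> is the zero space; hence the absolute value.\<close>
  have "\<bar>K\<bar>-lipschitz_on S f"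
  proof (rule lipschitz_onI)
    fix x y assume xy: "x \<in> S" "y \<in> S"
    then have "x - y \<in> S"
      using S complex_vector.subspace_diff by blast
    then have "norm (f (x - y)) \<le> K * norm (x - y)"
      using K by blast
    also have "\<dots> \<le> \<bar>K\<bar> * norm (x - y)"
      by (simp add: mult_right_mono)
    finally show "dist (f x) (f y) \<le> \<bar>K\<bar> * dist x y"
      using minus[OF xy] by (simp add: dist_norm)
  qed simp
  then show ?thesis
    by (rule lipschitz_on_continuous_on)
qed

text \<open>In a summand such as \<open>\<alpha> (br (\<alpha> x) (\<alpha> (br y z)))\<close> the
  outer twisted bracket contributes one \<open>\<alpha>\<close>, and multiplicativity pulls a second
  one out of the two arguments. Additivity then collects the three summands.\<close>

lemma hom_jacobian_twist:
  assumes lin: "clinear_on S \<alpha>"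
    and closed: "\<And>x y. x \<in> S \<Longrightarrow> y \<in> S \<Longrightarrow> br x y \<in> S"
    and hom: "\<And>x y. x \<in> S \<Longrightarrow> y \<in> S \<Longrightarrow> \<alpha> (br x y) = br (\<alpha> x) (\<alpha> y)"
    and S: "complex_vector.subspace S"
    and xyz: "x \<in> S" "y \<in> S" "z \<in> S"
  shows "hom_jacobian \<alpha> (\<lambda>x y. \<alpha> (br x y)) x y z = \<alpha> (\<alpha> (malcev_jacobian br x y z))"
proof -
  have maps: "\<And>u. u \<in> S \<Longrightarrow> \<alpha> u \<in> S"
    and add: "\<And>u v. u \<in> S \<Longrightarrow> v \<in> S \<Longrightarrow> \<alpha> (u + v) = \<alpha> u + \<alpha> v"
    using lin by (auto simp: clinear_on_def)
  have plus: "\<And>u v. u \<in> S \<Longrightarrow> v \<in> S \<Longrightarrow> u + v \<in> S"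
    using S complex_vector.subspace_add by blast
  show ?thesis
    using xyz unfolding hom_jacobian_def malcev_jacobian_def
    by (simp add: add plus maps closed hom)
qed

text \<open>\<open>\<alpha>\<close> passes through nested brackets and sums. This supplies the third
  power of \<open>\<alpha>\<close>, on top of the two from
  \<open>hom_jacobian_twist\<close>.\<close>

lemma malcev_jacobian_hom:
  assumes lin: "clinear_on S \<alpha>"
    and closed: "\<And>x y. x \<in> S \<Longrightarrow> y \<in> S \<Longrightarrow> br x y \<in> S"
    and hom: "\<And>x y. x \<in> S \<Longrightarrow> y \<in> S \<Longrightarrow> \<alpha> (br x y) = br (\<alpha> x) (\<alpha> y)"
    and S: "complex_vector.subspace S"
    and xyz: "x \<in> S" "y \<in> S" "z \<in> S"
  shows "malcev_jacobian br (\<alpha> x) (\<alpha> y) (\<alpha> z) = \<alpha> (malcev_jacobian br x y z)"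
proof -
  have maps: "\<And>u. u \<in> S \<Longrightarrow> \<alpha> u \<in> S"
    and add: "\<And>u v. u \<in> S \<Longrightarrow> v \<in> S \<Longrightarrow> \<alpha> (u + v) = \<alpha> u + \<alpha> v"
    using lin by (auto simp: clinear_on_def)
  have plus: "\<And>u v. u \<in> S \<Longrightarrow> v \<in> S \<Longrightarrow> u + v \<in> S"
    using S complex_vector.subspace_add by blast
  show ?thesis
    using xyz unfolding malcev_jacobian_def
    by (simp add: add plus maps closed hom)
qed

lemma continuous_bilinear_on_compose:
  assumes br: "continuous_bilinear_on S br" and f: "bounded_clinear_on S f"
    and S: "complex_vector.subspace S"
  shows "continuous_bilinear_on S (\<lambda>x y. f (br x y))"
proof -
  have lin: "clinear_on S f"
    using f by (simp add: bounded_clinear_on_def)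
  have left: "clinear_on S (\<lambda>y. br x y)" and right: "clinear_on S (\<lambda>y. br y x)"
    if "x \<in> S" for x
    using br that by (auto simp: continuous_bilinear_on_def)
  have compose: "clinear_on S (\<lambda>x. f (g x))" if "clinear_on S g" for g
    using that lin by (simp add: clinear_on_def)
  \<comment> \<open>\<open>f\<close> is known to be continuous only on \<open>S\<close>, so
    composing requires the values of the bracket to stay there.\<close>
  have "(\<lambda>(x, y). br x y) ` (S \<times> S) \<subseteq> S"
    using left by (auto simp: clinear_on_def)
  moreover have "continuous_on (S \<times> S) (\<lambda>(x, y). br x y)"
    using br by (simp add: continuous_bilinear_on_def)
  ultimately have "continuous_on (S \<times> S) (\<lambda>p. f ((\<lambda>(x, y). br x y) p))"
    using bounded_clinear_on_imp_continuous_on[OF f S] continuous_on_compose2 by blast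
  then show ?thesis
    using left right compose by (simp add: continuous_bilinear_on_def case_prod_beta')
qed

text \<open>This is the Yau twist of a Malcev algebra along a bounded endomorphism, on an arbitrary
  carrier.\<close>

lemma hom_banach_malcev_algebra_twist:
  assumes alg: "banach_malcev_algebra S br"
    and bounded: "bounded_clinear_on S \<alpha>"
    and hom: "\<And>x y. x \<in> S \<Longrightarrow> y \<in> S \<Longrightarrow> \<alpha> (br x y) = br (\<alpha> x) (\<alpha> y)"
  shows "hom_banach_malcev_algebra S (\<lambda>x y. \<alpha> (br x y)) \<alpha>"
proof -
  have carrier: "banach_carrier S" and S: "complex_vector.subspace S"
    and malcev: "continuous_malcev_bracket_on S br" and bil: "continuous_bilinear_on S br"
    using alg
    unfolding banach_malcev_algebra_def banach_carrier_def continuous_malcev_bracket_on_def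
    by blast+
  have lin: "clinear_on S \<alpha>" and maps: "\<And>x. x \<in> S \<Longrightarrow> \<alpha> x \<in> S"
    using bounded by (auto simp: bounded_clinear_on_def clinear_on_def)
  have closed: "\<And>x y. x \<in> S \<Longrightarrow> y \<in> S \<Longrightarrow> br x y \<in> S"
    using bil by (simp add: continuous_bilinear_on_def clinear_on_def)
  have jac: "\<And>x y z. x \<in> S \<Longrightarrow> y \<in> S \<Longrightarrow> z \<in> S \<Longrightarrow> malcev_jacobian br x y z \<in> S"
    using S by (simp add: malcev_jacobian_def closed complex_vector.subspace_add)
  have twist: "hom_jacobian \<alpha> (\<lambda>x y. \<alpha> (br x y)) x y z = \<alpha> (\<alpha> (malcev_jacobian br x y z))"
    and equivariant: "malcev_jacobian br (\<alpha> x) (\<alpha> y) (\<alpha> z) = \<alpha> (malcev_jacobian br x y z)"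
    if "x \<in> S" "y \<in> S" "z \<in> S" for x y z
    using that lin S closed hom
    by (auto intro!: hom_jacobian_twist[where S = S] malcev_jacobian_hom[where S = S])
  have "hom_jacobian \<alpha> (\<lambda>x y. \<alpha> (br x y)) (\<alpha> x) (\<alpha> y) (\<alpha> (br x z))
      = \<alpha> (br (hom_jacobian \<alpha> (\<lambda>x y. \<alpha> (br x y)) x y z) (\<alpha> (\<alpha> x)))"
    if xyz: "x \<in> S" "y \<in> S" "z \<in> S" for x y z
  proof -
    let ?J = "malcev_jacobian br"
    have "hom_jacobian \<alpha> (\<lambda>x y. \<alpha> (br x y)) (\<alpha> x) (\<alpha> y) (\<alpha> (br x z))
        = \<alpha> (\<alpha> (?J (\<alpha> x) (\<alpha> y) (\<alpha> (br x z))))"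
      using xyz by (intro twist) (simp_all add: maps closed)
    \<comment> \<open>All three arguments, including the twisted bracket
      \<open>\<alpha> (br x z)\<close>, are images under \<open>\<alpha>\<close>, so a third
      \<open>\<alpha>\<close> comes out and the Malcev identity applies to what remains.\<close>
    also have "\<dots> = \<alpha> (\<alpha> (\<alpha> (?J x y (br x z))))"
      using xyz by (subst equivariant) (simp_all add: closed)
    also have "?J x y (br x z) = br (?J x y z) x"
      using malcev xyz unfolding continuous_malcev_bracket_on_def by blast
    \<comment> \<open>Two of the three powers move inside the bracket, giving the twisted Jacobian
      and \<open>\<alpha> (\<alpha> x)\<close>; the outermost one is the twist of the bracket
      itself.\<close>
    also have "\<alpha> (\<alpha> (\<alpha> (br (?J x y z) x))) = \<alpha> (br (\<alpha> (\<alpha> (?J x y z))) (\<alpha> (\<alpha> x)))"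
      using xyz by (simp add: hom maps jac)
    also have "\<alpha> (\<alpha> (?J x y z)) = hom_jacobian \<alpha> (\<lambda>x y. \<alpha> (br x y)) x y z"
      using xyz by (simp add: twist)
    finally show ?thesis .
  qed
  then show ?thesis
    unfolding hom_banach_malcev_algebra_def
    using carrier bounded malcev continuous_bilinear_on_compose[OF bil bounded S]
    \<comment> \<open>The untwisted Malcev bracket demanded by the definition is \<open>br\<close>
      itself.\<close>
    by (intro conjI exI[of _ br] ballI) simp_all
qed

theorem theorem3p7:
  fixes br :: "'a::cbanach \<Rightarrow> 'a \<Rightarrow> 'a" and \<alpha> :: "'a \<Rightarrow> 'a"
  assumes "banach_malcev_algebra UNIV br"
    and "banach_malcev_automorphism UNIV br \<alpha>"
    and "\<forall>x. almost_periodic \<alpha> x"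
  shows "(\<forall>x \<in> ap_elements \<alpha>. \<forall>y \<in> ap_elements \<alpha>. br x y \<in> ap_elements \<alpha>)
    \<and> hom_banach_malcev_algebra (ap_elements \<alpha>) (\<lambda>x y. \<alpha> (br x y)) \<alpha>"
proof -
  have "ap_elements \<alpha> = UNIV"
    using assms(3) by (simp add: ap_elements_def)
  moreover have "hom_banach_malcev_algebra UNIV (\<lambda>x y. \<alpha> (br x y)) \<alpha>"
    using assms(1,2)
    by (intro hom_banach_malcev_algebra_twist) (simp_all add: banach_malcev_automorphism_def)
  \<comment> \<open>Rewriting the carrier to \<open>UNIV\<close> makes invariance under
    \<open>br\<close> trivial and leaves exactly the twist of the whole algebra.\<close>
  ultimately show ?thesis
    by simp
qed

end
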